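(* Let $f\in C^1(\mathbb{R}^+)\cap L^\infty(\mathbb{R}^+)$ with $f(0)=0$. (i) For every $\delta$ with $0<\delta<1$ there are constants $C_1,C_2>0$ (independent of $f$) such that $$\int_0^\infty\frac{f(x)^2}{x^{2+\delta}}\,dx\ \ge\ C_1\left(\int_0^\infty\frac{|f(x)|}{x^{1+\delta}}\,dx\right)^2-C_2\left(1+\|f\|_{L^\infty}^2\right).$$ (ii) For every $0<\alpha<1/4$, every $0<\delta<1-4\alpha$ and every $\epsilon>0$ there is a constant $C_\epsilon$ (independent of $f$) such that $$\int_0^\infty\frac{f(x)}{x^{1+\delta+2\alpha}}\,dx\ \le\ \epsilon\int_0^\infty\frac{f(x)^2}{x^{2+\delta}}\,dx+C_\epsilon\left(1+\|f\|_{L^\infty}\right).$$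
   Context: Here $\mathbb{R}^+=[0,\infty)$, with $C^1$ regularity up to $x=0$. The constants $C_1,C_2$ may depend on $\delta$, and $C_\epsilon$ may depend on $\alpha,\delta,\epsilon$. *)

theory Defs
  imports "HOL-Analysis.Analysis" "HOL-Probability.Essential_Supremum"
begin

text \<open>Functions on the closed half-line are functions \<^typ>\<open>real \<Rightarrow> real\<close> of which only the
  values on \<^term>\<open>{0..} :: real set\<close> are used. Differentiability is relative to the half-line,
  hence one-sided at the origin; this is why \<^const>\<open>C1_differentiable_on\<close>, which
  asks for a two-sided derivative, is not used.\<close>

definition C1_halfline :: "(real \<Rightarrow> real) \<Rightarrow> bool" where
  "C1_halfline f \<longleftrightarrow>
     (\<exists>f'. (\<forall>x\<in>{0..}. (f has_real_derivative f' x) (at x within {0..})) \<and> continuous_on {0..} f')"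

definition Linf_halfline :: "(real \<Rightarrow> real) \<Rightarrow> bool" where
  "Linf_halfline f \<longleftrightarrow>
     f \<in> borel_measurable (lebesgue_on {0..}) \<and> esssup (lebesgue_on {0..}) (\<lambda>x. ereal \<bar>f x\<bar>) < \<infinity>"

definition Linf_norm :: "(real \<Rightarrow> real) \<Rightarrow> real" where
  "Linf_norm f = real_of_ereal (esssup (lebesgue_on {0..}) (\<lambda>x. ereal \<bar>f x\<bar>))"

end

theory Submission
  imports Defs
begin

text \<open>On \<open>[0, 1]\<close> the AM-GM inequality gives, for every \<open>t > 0\<close>,
  \<open>|f| / x\<^bsup>1+\<delta>+\<beta>\<^esup> \<le> t f\<^sup>2 / x\<^bsup>2+\<delta>\<^esup> + x\<^bsup>-(\<delta>+2\<beta>)\<^esup> / (4t)\<close>, and the last term is integrable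
  there because \<open>\<delta> + 2\<beta> < 1\<close>; on \<open>[1, \<infinity>)\<close> the left-hand side is at most
  \<open>\<parallel>f\<parallel> x\<^bsup>-(1+\<delta>+\<beta>)\<^esup>\<close>. Part (i) is \<open>\<beta> = 0\<close> with \<open>t\<close> optimised, part (ii) is \<open>\<beta> = 2\<alpha>\<close>
  with \<open>t = \<epsilon>\<close>. The integral of \<open>f\<^sup>2 / x\<^bsup>2+\<delta>\<^esup>\<close> is finite since \<open>f x = O(x)\<close> at the origin.\<close>

section \<open>Power weights near 0 and near infinity\<close>

text \<open>Nonnegativity turns gauge integrability into absolute integrability, so the library's
  gauge integrals of powers become Lebesgue integrals. Keeping the piece \<open>B\<close> as an
  indicator lets integrals over different pieces be added under the single measure
  \<open>lebesgue_on A\<close>.\<close>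

lemma has_bochner_integral_lebesgue_on_indicator:
  fixes g :: "real \<Rightarrow> real"
  assumes "(g has_integral I) B" and "B \<subseteq> A" and "A \<in> sets lebesgue"
    and "\<And>x. x \<in> B \<Longrightarrow> 0 \<le> g x"
  shows "has_bochner_integral (lebesgue_on A) (\<lambda>x. indicator B x * g x) I"
proof -
  have g: "g absolutely_integrable_on B"
    using assms by (intro nonnegative_absolutely_integrable_1) auto
  then have "has_bochner_integral lebesgue (\<lambda>x. indicator B x *\<^sub>R g x) I"
    using set_lebesgue_integral_eq_integral(2)[OF g] integral_unique[OF assms(1)]
    by (simp add: has_bochner_integral_iff set_integrable_def set_lebesgue_integral_def)
  moreover have "(\<lambda>x. indicator A x *\<^sub>R (indicator B x * g x)) = (\<lambda>x. indicator B x *\<^sub>R g x)"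
    using assms(2) by (auto simp: fun_eq_iff indicator_def)
  ultimately show ?thesis
    using assms(3) by (subst has_bochner_integral_restrict_space) auto
qed

lemma has_bochner_integral_powr_near_0:
  fixes a :: real
  assumes "a < 1"
  shows "has_bochner_integral (lebesgue_on {0..})
           (\<lambda>x. indicator {0..1} x * x powr (-a)) (1 / (1 - a))"
  using has_integral_powr_from_0[of "-a" 1] assms
  by (intro has_bochner_integral_lebesgue_on_indicator) auto

lemma has_bochner_integral_powr_near_infinity:
  fixes b :: real
  assumes "1 < b"
  shows "has_bochner_integral (lebesgue_on {0..})
           (\<lambda>x. indicator {1..} x * x powr (-b)) (1 / (b - 1))"
proof -
  have "- 1 / (- b + 1) = 1 / (b - 1)"
    using assms by (simp add: field_simps)
  then show ?thesis
    using has_integral_powr_to_inf[of "-b" 1] assms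
    by (intro has_bochner_integral_lebesgue_on_indicator) auto
qed

section \<open>The sup norm as an almost everywhere bound\<close>

text \<open>Finiteness of the essential supremum is what makes \<open>real_of_ereal\<close> harmless
  here, since an infinite value would be sent to 0.\<close>

lemma AE_abs_le_Linf_norm:
  assumes "Linf_halfline f"
  shows "AE x in lebesgue_on {0..}. \<bar>f x\<bar> \<le> Linf_norm f"
proof -
  let ?E = "esssup (lebesgue_on {0..}) (\<lambda>x. ereal \<bar>f x\<bar>)"
  have "?E < \<infinity>"
    using assms by (simp add: Linf_halfline_def)
  then have "\<bar>f x\<bar> \<le> real_of_ereal ?E" if "ereal \<bar>f x\<bar> \<le> ?E" for x
    using that by (cases ?E) auto
  then show ?thesis
    using esssup_AE[of "\<lambda>x. ereal \<bar>f x\<bar>" "lebesgue_on {0..}"] by (auto simp: Linf_norm_def)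
qed

text \<open>A negative norm would make the almost everywhere bound
  \<open>\<bar>f x\<bar> \<le> Linf_norm f\<close> false at every point, so the half-line would be a
  null set; but it contains the unit interval.\<close>

lemma Linf_norm_nonneg:
  assumes "Linf_halfline f"
  shows "0 \<le> Linf_norm f"
proof (rule ccontr)
  assume neg: "\<not> 0 \<le> Linf_norm f"
  have "AE x in lebesgue_on {0::real..}. False"
    using AE_abs_le_Linf_norm[OF assms] by eventually_elim (use neg in linarith)
  then have "ae_filter (lebesgue_on {0::real..}) = bot"
    by (simp only: trivial_limit_def)
  then have "emeasure (lebesgue_on {0::real..}) {0..} = 0"
    by (simp add: ae_filter_eq_bot_iff)
  then have "emeasure lebesgue {0::real..} = 0"
    by (subst (asm) emeasure_restrict_space) auto
  moreover have "emeasure lebesgue {0..1::real} \<le> emeasure lebesgue {0::real..}"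
    by (intro emeasure_mono) auto
  ultimately show False
    by simp
qed

section \<open>Finiteness of the weighted square integral\<close>

text \<open>The derivative is continuous up to the origin, hence bounded on the compact interval
  \<open>{0..1}\<close>; the mean value inequality from 0 does the rest.\<close>

lemma C1_halfline_linear_bound:
  assumes "C1_halfline f" and "f 0 = 0"
  obtains L where "\<And>x. x \<in> {0..1} \<Longrightarrow> \<bar>f x\<bar> \<le> L * x"
proof -
  obtain f' where f': "\<And>x. x \<in> {0..} \<Longrightarrow> (f has_real_derivative f' x) (at x within {0..})"
    and "continuous_on {0..} f'"
    using assms(1) by (auto simp: C1_halfline_def)
  then have "continuous_on {0..1} f'"
    by (auto intro: continuous_on_subset)
  then have "bounded (f' ` {0..1})"
    by (intro compact_imp_bounded compact_continuous_image) auto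
  then obtain L where L: "\<And>x. x \<in> {0..1} \<Longrightarrow> norm (f' x) \<le> L"
    unfolding bounded_iff by blast
  have "\<bar>f x\<bar> \<le> L * x" if "x \<in> {0..1}" for x
  proof -
    have "norm (f x - f 0) \<le> L * norm (x - 0)"
    proof (rule field_differentiable_bound[of "{0..1}" f f'])
      show "(f has_real_derivative f' z) (at z within {0..1})" if "z \<in> {0..1}" for z
        using f'[of z] that by (auto intro: DERIV_subset)
    qed (use L that in auto)
    with that assms(2) show ?thesis by simp
  qed
  then show ?thesis
    using that by blast
qed

text \<open>The linear bound dominates the integrand by
  \<open>L\<^sup>2 * x powr (-\<delta>)\<close> up to 1, and the sup norm dominates it by an
  integrable tail beyond 1. Without integrability the Bochner integral would be 0 by default and
  could not bound anything from above.\<close>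

lemma integrable_weighted_square:
  fixes \<delta> :: real
  assumes "C1_halfline f" and "Linf_halfline f" and "f 0 = 0" and "0 < \<delta>" and "\<delta> < 1"
  shows "integrable (lebesgue_on {0..}) (\<lambda>x. (f x)\<^sup>2 / x powr (2 + \<delta>))"
proof -
  obtain L where L: "\<And>x. x \<in> {0..1} \<Longrightarrow> \<bar>f x\<bar> \<le> L * x"
    using C1_halfline_linear_bound assms by blast
  let ?M = "Linf_norm f"
  let ?h = "\<lambda>x. L\<^sup>2 * (indicator {0..1} x * x powr (-\<delta>)) +
                ?M\<^sup>2 * (indicator {1..} x * x powr (-(2 + \<delta>)))"
  have "integrable (lebesgue_on {0..}) ?h"
    using has_bochner_integral_powr_near_0[of \<delta>]
      has_bochner_integral_powr_near_infinity[of "2 + \<delta>"] assms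
    by (auto simp: has_bochner_integral_iff)
  moreover have "(\<lambda>x. (f x)\<^sup>2 / x powr (2 + \<delta>)) \<in> borel_measurable (lebesgue_on {0..})"
  proof -
    have [measurable]: "f \<in> borel_measurable (lebesgue_on {0..})"
      using assms by (simp add: Linf_halfline_def)
    have "(\<lambda>x. x) \<in> borel_measurable (lebesgue_on {0::real..})"
      by (intro continuous_imp_measurable_on_sets_lebesgue continuous_on_id) auto
    then have [measurable]: "(\<lambda>x. x powr (2 + \<delta>)) \<in> borel_measurable (lebesgue_on {0..})"
      by measurable
    show ?thesis by measurable
  qed
  moreover have "AE x in lebesgue_on {0..}. norm ((f x)\<^sup>2 / x powr (2 + \<delta>)) \<le> norm (?h x)"
  proof -
    have le: "(f x)\<^sup>2 / x powr (2 + \<delta>) \<le> ?h x" if "0 \<le> x" and "\<bar>f x\<bar> \<le> ?M" for x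
    proof (cases "x \<le> 1")
      case True
      show ?thesis
      proof (cases "x = 0")
        case False
        with that have x: "0 < x" by simp
        have "(f x)\<^sup>2 \<le> (L * x)\<^sup>2"
          using L[of x] True x by (intro abs_le_square_iff[THEN iffD1]) auto
        then have "(f x)\<^sup>2 / x powr (2 + \<delta>) \<le> (L * x)\<^sup>2 / x powr (2 + \<delta>)"
          by (intro divide_right_mono) auto
        also have "\<dots> = L\<^sup>2 * x powr (-\<delta>)"
          using x by (simp add: powr_add powr_minus field_simps)
        also have "\<dots> \<le> ?h x"
          using True x by simp
        finally show ?thesis .
      \<comment> \<open>At the origin both sides vanish, because \<open>f 0 = 0\<close> and
        \<open>0 powr a = 0\<close>.\<close>
      qed (use assms in auto)
    next
      case False
      have "(f x)\<^sup>2 \<le> ?M\<^sup>2"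
        using that by (intro abs_le_square_iff[THEN iffD1]) auto
      then have "(f x)\<^sup>2 / x powr (2 + \<delta>) \<le> ?M\<^sup>2 / x powr (2 + \<delta>)"
        by (intro divide_right_mono) auto
      also have "\<dots> = ?h x"
        using False by (simp add: powr_minus divide_inverse del: minus_add_distrib)
      finally show ?thesis .
    qed
    show ?thesis
      using AE_abs_le_Linf_norm[OF assms(2)] AE_space
    proof eventually_elim
      case (elim x)
      then show ?case
        using le[of x] abs_ge_self[of "?h x"] by simp
    qed
  qed
  ultimately show ?thesis
    by (rule Bochner_Integration.integrable_bound)
qed

section \<open>Interpolation between the weighted integrals\<close>

lemma weighted_integral_interpolation:
  fixes \<beta> \<delta> t :: real
  assumes "C1_halfline f" and "Linf_halfline f" and "f 0 = 0"
    and "0 < \<delta>" and "0 \<le> \<beta>" and "\<delta> + 2 * \<beta> < 1" and "0 < t"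
  shows "(LINT x|lebesgue_on {0..}. \<bar>f x\<bar> / x powr (1 + \<delta> + \<beta>))
         \<le> t * (LINT x|lebesgue_on {0..}. (f x)\<^sup>2 / x powr (2 + \<delta>))
           + 1 / (4 * (1 - (\<delta> + 2 * \<beta>))) / t + Linf_norm f / (\<delta> + \<beta>)"
proof -
  let ?M = "Linf_norm f"
  let ?q = "\<lambda>x. (f x)\<^sup>2 / x powr (2 + \<delta>)"
  let ?h = "\<lambda>x. t * ?q x + 1 / (4 * t) * (indicator {0..1} x * x powr (-(\<delta> + 2 * \<beta>))) +
                ?M * (indicator {1..} x * x powr (-(1 + \<delta> + \<beta>)))"
  have M: "0 \<le> ?M"
    using assms by (intro Linf_norm_nonneg)
  have h: "has_bochner_integral (lebesgue_on {0..}) ?h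
      (t * (LINT x|lebesgue_on {0..}. ?q x) + 1 / (4 * t) * (1 / (1 - (\<delta> + 2 * \<beta>))) +
       ?M * (1 / (1 + \<delta> + \<beta> - 1)))"
    using assms integrable_weighted_square[of f \<delta>]
    by (intro has_bochner_integral_add has_bochner_integral_mult_right
        has_bochner_integral_powr_near_0 has_bochner_integral_powr_near_infinity
        has_bochner_integral_integrable) auto
  have nonneg: "0 \<le> ?h x" for x
    using M assms by (intro add_nonneg_nonneg mult_nonneg_nonneg) auto
  have le: "\<bar>f x\<bar> / x powr (1 + \<delta> + \<beta>) \<le> ?h x" if "0 \<le> x" and "\<bar>f x\<bar> \<le> ?M" for x
  proof (cases "x \<le> 1")
    case True
    show ?thesis
    proof (cases "x = 0")
      case False
      with that have x: "0 < x" by simp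
      \<comment> \<open>The weight is split so that \<open>u * v\<close> is the integrand on the
        left, \<open>u\<^sup>2\<close> is the weighted square and \<open>v\<^sup>2\<close> is a pure
        power integrable at 0.\<close>
      define u where "u = \<bar>f x\<bar> / x powr (1 + \<delta> / 2)"
      define v where "v = x powr (-(\<delta> / 2 + \<beta>))"
      \<comment> \<open>Expanding and dividing by \<open>4 * t\<close> gives the weighted AM-GM
        inequality.\<close>
      have "0 \<le> (2 * t * u - v)\<^sup>2"
        by simp
      then have "u * v \<le> t * u\<^sup>2 + 1 / (4 * t) * v\<^sup>2"
        using \<open>0 < t\<close> by (simp add: power2_eq_square field_simps)
      moreover have "u * v = \<bar>f x\<bar> / x powr (1 + \<delta> + \<beta>)"
      proof -
        have "1 + \<delta> + \<beta> = (1 + \<delta> / 2) + (\<delta> / 2 + \<beta>)"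
          by simp
        then have eq: "x powr (1 + \<delta> + \<beta>) = x powr (1 + \<delta> / 2) * x powr (\<delta> / 2 + \<beta>)"
          by (simp only: powr_add)
        show ?thesis
          unfolding u_def v_def powr_minus eq
          by (simp only: divide_inverse inverse_mult_distrib mult.assoc)
      qed
      moreover have "u\<^sup>2 = ?q x"
      proof -
        have "(x powr (1 + \<delta> / 2))\<^sup>2 = x powr (2 + \<delta>)"
          by (simp add: power2_eq_square powr_add[symmetric])
        then show ?thesis by (simp add: u_def power_divide)
      qed
      moreover have "v\<^sup>2 = x powr (-(\<delta> + 2 * \<beta>))"
        by (simp add: v_def power2_eq_square powr_add[symmetric])
      \<comment> \<open>Both indicators equal 1 at \<open>x = 1\<close>, so the tail term of
        \<open>?h\<close> may be present in this case too; it only enlarges the bound.\<close>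
      moreover have "0 \<le> ?M * (indicator {1..} x * x powr (-(1 + \<delta> + \<beta>)))"
        using M by simp
      ultimately show ?thesis
        using True x by simp
    qed (use assms in auto)
  next
    case False
    have "\<bar>f x\<bar> / x powr (1 + \<delta> + \<beta>) \<le> ?M / x powr (1 + \<delta> + \<beta>)"
      using that by (intro divide_right_mono) auto
    also have "\<dots> = ?M * x powr (-(1 + \<delta> + \<beta>))"
      unfolding powr_minus by (simp add: divide_inverse)
    also have "\<dots> \<le> ?h x"
      using False \<open>0 < t\<close> by simp
    finally show ?thesis .
  qed
  have "AE x in lebesgue_on {0..}. \<bar>f x\<bar> / x powr (1 + \<delta> + \<beta>) \<le> ?h x"
    using AE_abs_le_Linf_norm[OF assms(2)] AE_space
  proof eventually_elim
    case (elim x)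
    then show ?case
      by (intro le) auto
  qed
  \<comment> \<open>This form of monotonicity asks for integrability of the majorant only;
    nonnegativity of \<open>?h\<close> covers the default value 0 of the left-hand integral.\<close>
  then have "(LINT x|lebesgue_on {0..}. \<bar>f x\<bar> / x powr (1 + \<delta> + \<beta>)) \<le> (LINT x|lebesgue_on {0..}. ?h x)"
    using h nonneg by (intro integral_mono_AE') (auto simp: has_bochner_integral_iff)
  also have "\<dots> = t * (LINT x|lebesgue_on {0..}. ?q x) + 1 / (4 * t) * (1 / (1 - (\<delta> + 2 * \<beta>))) +
       ?M * (1 / (1 + \<delta> + \<beta> - 1))"
    using h by (rule has_bochner_integral_integral_eq)
  finally show ?thesis
    by (simp add: algebra_simps)
qed

text \<open>Choosing \<open>t\<close> well turns the family of linear bounds into a quadratic one.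
  If \<open>J\<close> exceeds \<open>B\<close>, the excess \<open>d\<close> satisfies
  \<open>d\<^sup>2 \<le> 4 * A * I\<close>; otherwise \<open>B\<^sup>2\<close> alone
  suffices.\<close>

lemma square_le_of_forall_weighted_bound:
  fixes I J A B :: real
  assumes "\<And>t. 0 < t \<Longrightarrow> J \<le> t * I + A / t + B" and "0 \<le> I" and "0 \<le> J" and "0 < A"
  shows "J\<^sup>2 \<le> 8 * A * I + 2 * B\<^sup>2"
proof (cases "J \<le> B")
  case True
  then have "J\<^sup>2 \<le> B\<^sup>2"
    using assms by (intro power_mono)
  moreover have "0 \<le> A * I"
    using assms by simp
  ultimately show ?thesis
    using zero_le_power2[of B] by linarith
next
  case False
  define d where "d = J - B"
  have d: "0 < d"
    using False by (simp add: d_def)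
  \<comment> \<open>With \<open>t = 2 * A / d\<close> the term \<open>A / t\<close> is exactly
    \<open>d / 2\<close> and is absorbed on the left. Unlike the minimiser
    \<open>sqrt (A / I)\<close>, this choice needs no separate case \<open>I = 0\<close>.\<close>
  have "d \<le> 2 * A / d * I + d / 2"
    using assms(1)[of "2 * A / d"] d \<open>0 < A\<close> by (simp add: d_def)
  then have "d\<^sup>2 \<le> 4 * A * I"
    using d by (simp add: field_simps power2_eq_square)
  moreover have "J\<^sup>2 \<le> 2 * d\<^sup>2 + 2 * B\<^sup>2"
    using zero_le_power2[of "d - B"] by (simp add: d_def power2_eq_square algebra_simps)
  ultimately show ?thesis
    by linarith
qed

theorem lemma6p2:
  shows
    "(\<forall>\<delta>::real. 0 < \<delta> \<and> \<delta> < 1 \<longrightarrow>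
       (\<exists>C1 C2 :: real. C1 > 0 \<and> C2 > 0 \<and>
         (\<forall>f :: real \<Rightarrow> real. C1_halfline f \<and> Linf_halfline f \<and> f 0 = 0 \<longrightarrow>
            (LINT x|lebesgue_on {0..}. (f x)\<^sup>2 / x powr (2 + \<delta>))
              \<ge> C1 * (LINT x|lebesgue_on {0..}. \<bar>f x\<bar> / x powr (1 + \<delta>))\<^sup>2
                 - C2 * (1 + (Linf_norm f)\<^sup>2))))
     \<and>
     (\<forall>(\<alpha>::real) (\<delta>::real) (\<epsilon>::real).
       0 < \<alpha> \<and> \<alpha> < 1 / 4 \<and> 0 < \<delta> \<and> \<delta> < 1 - 4 * \<alpha> \<and> \<epsilon> > 0 \<longrightarrow>
       (\<exists>C :: real.
         (\<forall>f :: real \<Rightarrow> real. C1_halfline f \<and> Linf_halfline f \<and> f 0 = 0 \<longrightarrow>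
            (LINT x|lebesgue_on {0..}. f x / x powr (1 + \<delta> + 2 * \<alpha>))
              \<le> \<epsilon> * (LINT x|lebesgue_on {0..}. (f x)\<^sup>2 / x powr (2 + \<delta>))
                 + C * (1 + Linf_norm f))))"
proof (intro conjI allI impI)
  fix \<delta> :: real
  assume \<delta>: "0 < \<delta> \<and> \<delta> < 1"
  \<comment> \<open>\<open>C1\<close> is the reciprocal of the coefficient
    \<open>8 * (1 / (4 * (1 - \<delta>)))\<close> that the optimised bound puts on the square
    integral, and \<open>C2\<close> is \<open>C1 * 2 / \<delta>\<^sup>2\<close>.\<close>
  define C1 where "C1 = (1 - \<delta>) / 2"
  define C2 where "C2 = (1 - \<delta>) / \<delta>\<^sup>2"
  have C: "C1 > 0" "C2 > 0"
    using \<delta> by (auto simp: C1_def C2_def)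
  have "C1 * (LINT x|lebesgue_on {0..}. \<bar>f x\<bar> / x powr (1 + \<delta>))\<^sup>2 - C2 * (1 + (Linf_norm f)\<^sup>2)
        \<le> (LINT x|lebesgue_on {0..}. (f x)\<^sup>2 / x powr (2 + \<delta>))"
    if f: "C1_halfline f \<and> Linf_halfline f \<and> f 0 = 0" for f
  proof -
    define I where "I = (LINT x|lebesgue_on {0..}. (f x)\<^sup>2 / x powr (2 + \<delta>))"
    define J where "J = (LINT x|lebesgue_on {0..}. \<bar>f x\<bar> / x powr (1 + \<delta>))"
    have "J\<^sup>2 \<le> 8 * (1 / (4 * (1 - \<delta>))) * I + 2 * (Linf_norm f / \<delta>)\<^sup>2"
    proof (rule square_le_of_forall_weighted_bound)
      show "J \<le> t * I + 1 / (4 * (1 - \<delta>)) / t + Linf_norm f / \<delta>" if "0 < t" for t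
        using weighted_integral_interpolation[of f \<delta> 0 t] f \<delta> that by (simp add: I_def J_def)
    qed (use \<delta> in \<open>auto simp: I_def J_def\<close>)
    then have "C1 * J\<^sup>2 \<le> C1 * (8 * (1 / (4 * (1 - \<delta>))) * I + 2 * (Linf_norm f / \<delta>)\<^sup>2)"
      using C by (intro mult_left_mono) auto
    also have "\<dots> = I + C2 * (Linf_norm f)\<^sup>2"
    proof -
      have "C1 * (8 * (1 / (4 * (1 - \<delta>)))) = 1"
        using \<delta> by (simp add: C1_def divide_simps)
      moreover have "C1 * (2 * (Linf_norm f / \<delta>)\<^sup>2) = C2 * (Linf_norm f)\<^sup>2"
        by (simp add: C1_def C2_def power_divide)
      ultimately show ?thesis
        by (simp only: distrib_left mult.assoc[symmetric] mult_1)
    qed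
    finally show ?thesis
      using C by (simp add: I_def J_def distrib_left)
  qed
  with C show "\<exists>C1 C2 :: real. C1 > 0 \<and> C2 > 0 \<and>
         (\<forall>f :: real \<Rightarrow> real. C1_halfline f \<and> Linf_halfline f \<and> f 0 = 0 \<longrightarrow>
            (LINT x|lebesgue_on {0..}. (f x)\<^sup>2 / x powr (2 + \<delta>))
              \<ge> C1 * (LINT x|lebesgue_on {0..}. \<bar>f x\<bar> / x powr (1 + \<delta>))\<^sup>2
                 - C2 * (1 + (Linf_norm f)\<^sup>2))"
    by blast
next
  fix \<alpha> \<delta> \<epsilon> :: real
  assume *: "0 < \<alpha> \<and> \<alpha> < 1 / 4 \<and> 0 < \<delta> \<and> \<delta> < 1 - 4 * \<alpha> \<and> \<epsilon> > 0"
  \<comment> \<open>\<open>A\<close> and \<open>B\<close> are the constants of the interpolation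
    bound at \<open>\<beta> = 2 * \<alpha>\<close> and \<open>t = \<epsilon>\<close>; its condition
    \<open>\<delta> + 2 * \<beta> < 1\<close> then reads
    \<open>\<delta> < 1 - 4 * \<alpha>\<close>.\<close>
  define A where "A = 1 / (4 * (1 - (\<delta> + 2 * (2 * \<alpha>)))) / \<epsilon>"
  define B where "B = 1 / (\<delta> + 2 * \<alpha>)"
  have AB: "0 \<le> A" "0 \<le> B"
    using * by (auto simp: A_def B_def)
  have "(LINT x|lebesgue_on {0..}. f x / x powr (1 + \<delta> + 2 * \<alpha>))
        \<le> \<epsilon> * (LINT x|lebesgue_on {0..}. (f x)\<^sup>2 / x powr (2 + \<delta>)) + (A + B) * (1 + Linf_norm f)"
    if f: "C1_halfline f \<and> Linf_halfline f \<and> f 0 = 0" for f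
  proof -
    let ?I = "LINT x|lebesgue_on {0..}. (f x)\<^sup>2 / x powr (2 + \<delta>)"
    have M: "0 \<le> Linf_norm f"
      using f by (intro Linf_norm_nonneg) auto
    have "(LINT x|lebesgue_on {0..}. f x / x powr (1 + \<delta> + 2 * \<alpha>))
        \<le> (LINT x|lebesgue_on {0..}. norm (f x / x powr (1 + \<delta> + 2 * \<alpha>)))"
      using integral_norm_bound[of "lebesgue_on {0..}" "\<lambda>x. f x / x powr (1 + \<delta> + 2 * \<alpha>)"]
      by simp
    also have "\<dots> = (LINT x|lebesgue_on {0..}. \<bar>f x\<bar> / x powr (1 + \<delta> + 2 * \<alpha>))"
      by simp
    also have "\<dots> \<le> \<epsilon> * ?I + A + Linf_norm f / (\<delta> + 2 * \<alpha>)"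
      unfolding A_def using f * by (intro weighted_integral_interpolation) auto
    also have "\<dots> = \<epsilon> * ?I + A + B * Linf_norm f"
      by (simp add: B_def)
    \<comment> \<open>The product on the right adds only the nonnegative cross terms
      \<open>A * Linf_norm f\<close> and \<open>B\<close>.\<close>
    also have "\<dots> \<le> \<epsilon> * ?I + (A + B) * (1 + Linf_norm f)"
      using mult_nonneg_nonneg[OF AB(1) M] AB by (simp add: algebra_simps)
    finally show ?thesis .
  qed
  then show "\<exists>C :: real.
         (\<forall>f :: real \<Rightarrow> real. C1_halfline f \<and> Linf_halfline f \<and> f 0 = 0 \<longrightarrow>
            (LINT x|lebesgue_on {0..}. f x / x powr (1 + \<delta> + 2 * \<alpha>))
              \<le> \<epsilon> * (LINT x|lebesgue_on {0..}. (f x)\<^sup>2 / x powr (2 + \<delta>))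
                 + C * (1 + Linf_norm f))"
    by blast
qed

end
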